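(* Fix $N$, $\varepsilon\in(0,RL)$ and a deterministic algorithm whose guarantee threshold satisfies $0<\Lambda(\varepsilon)<\infty$, and write $\mathcal E_N(s)$ for its failure exponent at noise level $s$. Then $$\lim_{s\downarrow0}\ s^2\,\mathcal E_N(s)\;=\;\frac{\Lambda(\varepsilon)^2}{2}\,.$$
   Context: Fix a dimension $d\ge1$, $x_0\in\mathbb R^d$, $R,L>0$ and a number of queries $N\ge1$. Norms are Euclidean. Let $\mathcal C=\mathcal C(R,L)$ be the class of convex (possibly nonsmooth) functions $f:\mathbb R^d\to\mathbb R$ admitting a minimizer $x_\star$ with $\|x_0-x_\star\|\le R$ and such that $\|g\|\le L$ for every $x$ and every $g\in\partial f(x)$; write $f_\star=f(x_\star)$. Oracle and algorithm: for an instance $f$ the oracle uses a measurable selection $x\mapsto g(x)\in\partial f(x)$. A deterministic algorithm queries, for $k=0,\dots,N-1$, a point $x_k$ that is a deterministic measurable function of the previous answers $\tilde g_0,\dots,\tilde g_{k-1}$, receives $\tilde g_k=g(x_k)+e_k$, and finally returns $x_A$, a deterministic measurable function of $\tilde g_0,\dots,\tilde g_{N-1}$. Given $f$ and the selection, the suboptimality gap is thus a function of the noise path $e=(e_0,\dots,e_{N-1})$; write $G_f(e)=f(x_A)-f_\star$ for it, and $\|e\|^2=\sum_{k=0}^{N-1}\|e_k\|^2$. The guarantee threshold of the algorithm is $$\Lambda(\varepsilon)=\inf\big\{\|e\|:\ G_f(e)\ge\varepsilon\ \text{for some } f\in\mathcal C\ (\text{and some measurable subgradient selection})\big\}.$$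 For $s>0$, a law $P$ of the noise sequence is admissible at level $s$ if, with $\mathcal F_k=\sigma(e_0,\dots,e_{k-1})$, $\mathbb E_P[\exp\langle a,e_k\rangle\mid\mathcal F_k]\le\exp(s^2\|a\|^2/2)$ for all $a\in\mathbb R^d$ and all $k$. The failure exponent is $$\mathcal E_N(s)=-\log\,\sup_f\ \sup_P\ \mathbb P_P\big(f(x_A)-f_\star\ge\varepsilon\big),$$ the suprema running over $f\in\mathcal C$ (together with all measurable subgradient selections) and all laws $P$ admissible at level $s$. *)

theory Defs
  imports "HOL-Probability.Probability"
begin

section \<open>The function class and the oracle\<close>

definition subdifferential :: "('a::euclidean_space \<Rightarrow> real) \<Rightarrow> 'a \<Rightarrow> 'a set" where
  "subdifferential f x = {g. \<forall>y. f y \<ge> f x + g \<bullet> (y - x)}"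

definition fclass :: "'a::euclidean_space \<Rightarrow> real \<Rightarrow> real \<Rightarrow> ('a \<Rightarrow> real) set" where
  "fclass x0 R L = {f. convex_on UNIV f
     \<and> (\<exists>xs. is_arg_min f (\<lambda>_. True) xs \<and> norm (x0 - xs) \<le> R)
     \<and> (\<forall>x. \<forall>g \<in> subdifferential f x. norm g \<le> L)}"

definition fstar :: "('a::euclidean_space \<Rightarrow> real) \<Rightarrow> real" where
  "fstar f = f (arg_min f (\<lambda>_. True))"

text \<open>An instance is a function of the class together with a measurable subgradient selection.\<close>

definition instances ::
  "'a::euclidean_space \<Rightarrow> real \<Rightarrow> real \<Rightarrow> (('a \<Rightarrow> real) \<times> ('a \<Rightarrow> 'a)) set" where
  "instances x0 R L = {(f, g). f \<in> fclass x0 R L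
     \<and> g \<in> borel_measurable borel \<and> (\<forall>x. g x \<in> subdifferential f x)}"

section \<open>Deterministic algorithms\<close>

text \<open>Sequences of \<open>k\<close> vectors are the points of the product space over \<open>{..<k}\<close>, that is,
  functions on \<open>nat\<close> that are \<open>undefined\<close> outside \<open>{..<k}\<close>.\<close>

abbreviation path_space :: "nat \<Rightarrow> (nat \<Rightarrow> 'a::euclidean_space) measure" where
  "path_space k \<equiv> (\<Pi>\<^sub>M i\<in>{..<k}. borel)"

text \<open>\<open>qry k\<close> maps the first \<open>k\<close> answers to the \<open>k\<close>-th query point, and \<open>out\<close> maps all \<open>N\<close>
  answers to the returned point. The space \<open>path_space 0\<close> has a single point, so the query
  for \<open>k = 0\<close> is a constant.\<close>

definition algorithm ::
  "nat \<Rightarrow> (nat \<Rightarrow> (nat \<Rightarrow> 'a) \<Rightarrow> 'a::euclidean_space) \<Rightarrow> ((nat \<Rightarrow> 'a) \<Rightarrow> 'a) \<Rightarrow> bool" where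
  "algorithm N qry out \<longleftrightarrow>
     (\<forall>k<N. qry k \<in> borel_measurable (path_space k)) \<and> out \<in> borel_measurable (path_space N)"

lemma restrict_fundef_cong [fundef_cong]:
  "I = J \<Longrightarrow> (\<And>i. i \<in> J \<Longrightarrow> f i = g i) \<Longrightarrow> restrict f I = restrict g J"
  by (auto simp: restrict_def)

fun answer ::
  "(nat \<Rightarrow> (nat \<Rightarrow> 'a) \<Rightarrow> 'a::euclidean_space) \<Rightarrow> ('a \<Rightarrow> 'a) \<Rightarrow> (nat \<Rightarrow> 'a) \<Rightarrow> nat \<Rightarrow> 'a" where
  "answer qry g e k = g (qry k (\<lambda>i\<in>{..<k}. answer qry g e i)) + e k"

declare answer.simps [simp del]

definition gap ::
  "nat \<Rightarrow> (nat \<Rightarrow> (nat \<Rightarrow> 'a) \<Rightarrow> 'a::euclidean_space) \<Rightarrow> ((nat \<Rightarrow> 'a) \<Rightarrow> 'a) \<Rightarrow>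
   ('a \<Rightarrow> real) \<Rightarrow> ('a \<Rightarrow> 'a) \<Rightarrow> (nat \<Rightarrow> 'a) \<Rightarrow> real" where
  "gap N qry out f g e = f (out (\<lambda>i\<in>{..<N}. answer qry g e i)) - fstar f"

section \<open>The guarantee threshold\<close>

definition path_norm :: "nat \<Rightarrow> (nat \<Rightarrow> 'a::euclidean_space) \<Rightarrow> real" where
  "path_norm N e = sqrt (\<Sum>k<N. (norm (e k))\<^sup>2)"

text \<open>The infimum is taken in the extended reals, so that it is \<open>\<infinity>\<close> if no noise path leads to
  a gap of at least \<open>\<epsilon>\<close>.\<close>

definition threshold ::
  "'a::euclidean_space \<Rightarrow> real \<Rightarrow> real \<Rightarrow> nat \<Rightarrow> (nat \<Rightarrow> (nat \<Rightarrow> 'a) \<Rightarrow> 'a) \<Rightarrow> ((nat \<Rightarrow> 'a) \<Rightarrow> 'a) \<Rightarrow>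
   real \<Rightarrow> ereal" where
  "threshold x0 R L N qry out \<epsilon> =
     Inf {ereal (path_norm N e) | e. e \<in> space (path_space N) \<and>
            (\<exists>(f, g) \<in> instances x0 R L. gap N qry out f g e \<ge> \<epsilon>)}"

section \<open>Admissible noise laws and the failure exponent\<close>

definition past :: "(nat \<Rightarrow> 'a::euclidean_space) measure \<Rightarrow> nat \<Rightarrow> (nat \<Rightarrow> 'a) measure" where
  "past P k = sigma (space P) {(\<lambda>e. e i) -` A \<inter> space P | i A. i < k \<and> A \<in> sets borel}"

text \<open>The nonnegative conditional expectation is used because it may take the value \<open>\<infinity>\<close>; the
  real-valued one is \<open>0\<close> where the conditional exponential moment is infinite.\<close>

definition admissible :: "nat \<Rightarrow> real \<Rightarrow> (nat \<Rightarrow> 'a::euclidean_space) measure set" where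
  "admissible N s = {P. prob_space P \<and> sets P = sets (path_space N) \<and>
     (\<forall>a. \<forall>k<N. AE e in P.
        nn_cond_exp P (past P k) (\<lambda>e. ennreal (exp (a \<bullet> e k))) e
          \<le> ennreal (exp (s\<^sup>2 * (norm a)\<^sup>2 / 2)))}"

text \<open>If \<open>past P k\<close> were not a subalgebra of \<open>P\<close>, \<open>nn_cond_exp\<close> would be the constant \<open>0\<close>.\<close>

lemma subalgebra_past:
  fixes P :: "(nat \<Rightarrow> 'a::euclidean_space) measure"
  assumes "sets P = sets (path_space N)" and "k \<le> N"
  shows "subalgebra P (past P k)"
proof -
  have "(\<lambda>e. e i) -` A \<inter> space P \<in> sets P"
    if "i < k" "A \<in> sets borel" for i and A :: "'a set"
  proof -
    have "(\<lambda>e. e i) \<in> measurable (path_space N) (borel :: 'a measure)"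
      using that assms(2) by (intro measurable_component_singleton) auto
    then have "(\<lambda>e. e i) \<in> measurable P (borel :: 'a measure)"
      using assms(1) measurable_cong_sets by blast
    then show ?thesis
      using that(2) by (rule measurable_sets)
  qed
  then have "{(\<lambda>e. e i) -` A \<inter> space P | i A. i < k \<and> A \<in> sets borel} \<subseteq> sets P"
    by auto
  then show ?thesis
    by (simp add: past_def subalgebra_def space_measure_of_conv sets_measure_of_conv
        sets.sigma_sets_subset)
qed

definition failure_sup ::
  "'a::euclidean_space \<Rightarrow> real \<Rightarrow> real \<Rightarrow> nat \<Rightarrow> (nat \<Rightarrow> (nat \<Rightarrow> 'a) \<Rightarrow> 'a) \<Rightarrow> ((nat \<Rightarrow> 'a) \<Rightarrow> 'a) \<Rightarrow>
   real \<Rightarrow> real \<Rightarrow> ennreal" where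
  "failure_sup x0 R L N qry out \<epsilon> s =
     (SUP (f, g) \<in> instances x0 R L. SUP P \<in> admissible N s.
        emeasure P {e \<in> space P. gap N qry out f g e \<ge> \<epsilon>})"

definition neg_log :: "ennreal \<Rightarrow> ereal" where
  "neg_log p = (if p = 0 then \<infinity> else ereal (- ln (enn2real p)))"

definition failure_exponent ::
  "'a::euclidean_space \<Rightarrow> real \<Rightarrow> real \<Rightarrow> nat \<Rightarrow> (nat \<Rightarrow> (nat \<Rightarrow> 'a) \<Rightarrow> 'a) \<Rightarrow> ((nat \<Rightarrow> 'a) \<Rightarrow> 'a) \<Rightarrow>
   real \<Rightarrow> real \<Rightarrow> ereal" where
  "failure_exponent x0 R L N qry out \<epsilon> s = neg_log (failure_sup x0 R L N qry out \<epsilon> s)"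

end

theory Submission
  imports Defs "HOL-Real_Asymp.Real_Asymp"
begin

text \<open>A failure forces the noise path into the complement of the ball of radius \<open>\<Lambda>\<close>. By the tower
  property an admissible law satisfies the joint bound
  \<open>E exp (\<Sum>k. a k \<bullet> e k) \<le> exp (s\<^sup>2 \<parallel>a\<parallel>\<^sup>2 / 2)\<close>; the Chernoff bound over a finite net of directions \<open>a\<close>,
  whose cardinality does not depend on \<open>s\<close>, bounds the failure probability by
  \<open>C exp (- (1 - \<delta>) \<Lambda>\<^sup>2 / (2 s\<^sup>2))\<close>.

  Conversely, let \<open>v\<close> be a failing path with \<open>\<parallel>v\<parallel> < \<Lambda> + \<delta>\<close>. The gap need not be continuous in the
  noise, so the noise law must hit \<open>v\<close> exactly: take independent \<open>e k\<close> with values \<open>v k\<close>, \<open>- v k\<close>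
  (each with probability \<open>exp (- (1 + \<delta>) \<parallel>v k\<parallel>\<^sup>2 / (2 s\<^sup>2))\<close>) and \<open>0\<close>,
  or \<open>e k = 0\<close> if \<open>v k = 0\<close>. For small \<open>s\<close> this law is
  admissible at level \<open>s\<close>, and it has an atom of mass \<open>exp (- (1 + \<delta>) \<parallel>v\<parallel>\<^sup>2 / (2 s\<^sup>2))\<close> at \<open>v\<close>.\<close>

section \<open>Tails of admissible laws\<close>

lemma finite_net_cball:
  fixes \<eta> :: real
  assumes "\<eta> > 0"
  obtains D :: "'a::euclidean_space set" where "finite D"
    and "\<And>u. norm u \<le> 1 \<Longrightarrow> \<exists>d\<in>D. norm (u - d) < \<eta>"
proof -
  have "compact (cball (0::'a) 1)" by simp
  then obtain D where "D \<subseteq> cball (0::'a) 1" "finite D" "cball (0::'a) 1 \<subseteq> (\<Union>d\<in>D. ball d \<eta>)"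
    by (rule compactE_image[of _ "cball 0 1" "\<lambda>d. ball d \<eta>"]) (use assms in auto)
  then show thesis
    by (intro that[of D]) (auto simp: dist_norm norm_minus_commute subset_iff)
qed

lemma path_norm_nonneg: "path_norm N e \<ge> 0"
  by (simp add: path_norm_def sum_nonneg)

lemma path_norm_square: "(path_norm N e)\<^sup>2 = (\<Sum>k<N. (norm (e k))\<^sup>2)"
  by (simp add: path_norm_def sum_nonneg)

lemma norm_le_path_norm: "k < N \<Longrightarrow> norm (e k) \<le> path_norm N e"
  unfolding path_norm_def by (intro real_le_rsqrt member_le_sum) auto

text \<open>Each block of the normalized path is replaced by a net point at distance below
  \<open>\<eta>\<close>. Per block this costs at most \<open>\<eta>\<close> in the inner product, by
  Cauchy-Schwarz, and at most \<open>3 * \<eta>\<close> in the squared norm, since blocks have norm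
  at most 1. Hence paths of large norm are covered by finitely many half-spaces.\<close>

lemma net_direction:
  fixes e :: "nat \<Rightarrow> 'a::euclidean_space"
  assumes net: "\<And>u::'a. norm u \<le> 1 \<Longrightarrow> \<exists>d\<in>D. norm (u - d) < \<eta>"
    and \<eta>: "0 \<le> \<eta>" "\<eta> \<le> 1" and pos: "path_norm N e > 0"
  obtains a where "a \<in> (\<Pi>\<^sub>E k\<in>{..<N}. D)"
    and "(\<Sum>k<N. a k \<bullet> e k) \<ge> (1 - real N * \<eta>) * path_norm N e"
    and "(\<Sum>k<N. (norm (a k))\<^sup>2) \<le> 1 + 3 * real N * \<eta>"
proof -
  let ?r = "path_norm N e"
  define u where "u k = e k /\<^sub>R ?r" for k
  have u1: "norm (u k) \<le> 1" if "k < N" for k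
    using norm_le_path_norm[OF that, of e] pos by (simp add: u_def field_simps)
  have "\<exists>d. k < N \<longrightarrow> d \<in> D \<and> norm (u k - d) < \<eta>" for k
    using net[OF u1, of k] by blast
  then obtain b where b: "\<And>k. k < N \<Longrightarrow> b k \<in> D \<and> norm (u k - b k) < \<eta>" by metis
  define a where "a = restrict b {..<N}"
  have eu: "e k = ?r *\<^sub>R u k" for k using pos by (simp add: u_def)
  have u_sum: "(\<Sum>k<N. (norm (u k))\<^sup>2) = 1"
  proof -
    have "(\<Sum>k<N. (norm (u k))\<^sup>2) = (\<Sum>k<N. (norm (e k))\<^sup>2) / ?r\<^sup>2"
      using pos by (simp add: u_def power_mult_distrib sum_divide_distrib field_simps)
    also have "\<dots> = 1" using pos by (simp add: path_norm_square[symmetric])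
    finally show ?thesis .
  qed
  have "a k \<bullet> u k \<ge> (norm (u k))\<^sup>2 - \<eta>" if k: "k < N" for k
  proof -
    have "(u k - a k) \<bullet> u k \<le> norm (u k - a k) * norm (u k)" by (rule norm_cauchy_schwarz)
    also have "\<dots> \<le> \<eta> * 1"
      using b[OF k] u1[OF k] k \<eta> by (intro mult_mono) (auto simp: a_def)
    finally show ?thesis by (simp add: inner_diff_left power2_norm_eq_inner)
  qed
  then have "(\<Sum>k<N. a k \<bullet> u k) \<ge> (\<Sum>k<N. (norm (u k))\<^sup>2 - \<eta>)" by (intro sum_mono) auto
  then have "(\<Sum>k<N. a k \<bullet> u k) \<ge> 1 - N * \<eta>" by (simp add: sum_subtractf u_sum)
  then have "?r * (\<Sum>k<N. a k \<bullet> u k) \<ge> ?r * (1 - real N * \<eta>)" using pos by simp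
  moreover have "?r * (\<Sum>k<N. a k \<bullet> u k) = (\<Sum>k<N. a k \<bullet> e k)"
    by (subst eu) (simp add: sum_distrib_left)
  moreover have "(norm (a k))\<^sup>2 \<le> (norm (u k))\<^sup>2 + 3 * \<eta>" if k: "k < N" for k
  proof -
    have "norm (a k) \<le> norm (u k) + norm (u k - a k)"
      by (metis norm_triangle_sub norm_minus_commute)
    also have "\<dots> \<le> norm (u k) + \<eta>" using b[OF k] k by (simp add: a_def)
    finally have "(norm (a k))\<^sup>2 \<le> (norm (u k) + \<eta>)\<^sup>2" by (intro power_mono) auto
    also have "\<dots> = (norm (u k))\<^sup>2 + (2 * norm (u k) + \<eta>) * \<eta>"
      by (simp add: power2_eq_square algebra_simps)
    also have "\<dots> \<le> (norm (u k))\<^sup>2 + 3 * \<eta>"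
      using u1[OF k] \<eta> by (intro add_left_mono mult_right_mono) auto
    finally show ?thesis .
  qed
  then have "(\<Sum>k<N. (norm (a k))\<^sup>2) \<le> (\<Sum>k<N. (norm (u k))\<^sup>2 + 3 * \<eta>)" by (intro sum_mono) auto
  then have "(\<Sum>k<N. (norm (a k))\<^sup>2) \<le> 1 + 3 * real N * \<eta>" by (simp add: sum.distrib u_sum)
  moreover have "a \<in> (\<Pi>\<^sub>E k\<in>{..<N}. D)" using b by (auto simp: a_def)
  ultimately show thesis by (intro that) (auto simp: mult.commute)
qed

section \<open>Exponential moments and Chernoff bounds under an admissible law\<close>

lemma sets_past:
  "sets (past P k)
      = sigma_sets (space P) {(\<lambda>e. e i) -` A \<inter> space P | i A. i < k \<and> A \<in> sets borel}"
  unfolding past_def by (rule sets_measure_of) auto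

lemma measurable_past:
  assumes "i < k"
  shows "(\<lambda>e. e i) \<in> measurable (past P k) borel"
proof (rule measurableI)
  fix A :: "'a set" assume "A \<in> sets borel"
  moreover have "space (past P k) = space P"
    by (auto simp: past_def space_measure_of_conv)
  ultimately show "(\<lambda>e. e i) -` A \<inter> space (past P k) \<in> sets (past P k)"
    using assms unfolding sets_past by (auto intro!: sigma_sets.Basic)
qed simp

lemma borel_measurable_coordinate:
  fixes P :: "(nat \<Rightarrow> 'a::euclidean_space) measure"
  assumes "sets P = sets (path_space N)" and "k < N"
  shows "(\<lambda>e. e k) \<in> borel_measurable P"
  unfolding measurable_cong_sets[OF assms(1) refl]
  using assms(2) by (intro measurable_component_singleton) auto

text \<open>Induction on the number of steps: the earlier factors are measurable with respect to the
  past, so the newest factor may be replaced by its conditional expectation, which admissibility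
  bounds by a constant.\<close>

lemma admissible_exp_moment:
  fixes P :: "(nat \<Rightarrow> 'a::euclidean_space) measure"
  assumes P: "P \<in> admissible N s" and "n \<le> N"
  shows "(\<integral>\<^sup>+ e. ennreal (exp (\<Sum>k<n. a k \<bullet> e k)) \<partial>P)
    \<le> ennreal (exp (s\<^sup>2 / 2 * (\<Sum>k<n. (norm (a k))\<^sup>2)))"
  using \<open>n \<le> N\<close>
proof (induction n)
  case 0
  interpret prob_space P using P by (simp add: admissible_def)
  show ?case by (simp add: emeasure_space_1)
next
  case (Suc n)
  interpret prob_space P using P by (simp add: admissible_def)
  have sets_P: "sets P = sets (path_space N)" using P by (simp add: admissible_def)
  have sub: "subalgebra P (past P n)" using subalgebra_past[OF sets_P] Suc.prems by simp
  interpret sigma_finite_subalgebra P "past P n"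
    by (intro finite_measure_subalgebra_is_sigma_finite finite_measure_subalgebra.intro
      finite_measure_subalgebra_axioms.intro sub finite_measure_axioms)
  note meas_P = borel_measurable_coordinate[OF sets_P]
  let ?F = "\<lambda>e. ennreal (exp (\<Sum>k<n. a k \<bullet> e k))"
  let ?G = "\<lambda>e. ennreal (exp (a n \<bullet> e n))"
  let ?c = "ennreal (exp (s\<^sup>2 * (norm (a n))\<^sup>2 / 2))"
  have F: "?F \<in> borel_measurable (past P n)"
    using measurable_past[of _ n P] by (intro measurable_compose[OF _ measurable_ennreal]
      borel_measurable_exp[THEN measurable_compose[rotated]] borel_measurable_sum
      borel_measurable_inner borel_measurable_const) auto
  have G: "?G \<in> borel_measurable P"
    using meas_P[of n] Suc.prems by (intro measurable_compose[OF _ measurable_ennreal]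
      borel_measurable_exp[THEN measurable_compose[rotated]]
      borel_measurable_inner borel_measurable_const) auto
  have "(\<integral>\<^sup>+ e. ennreal (exp (\<Sum>k<Suc n. a k \<bullet> e k)) \<partial>P) = (\<integral>\<^sup>+ e. ?F e * ?G e \<partial>P)"
    by (simp add: exp_add ennreal_mult)
  \<comment> \<open>The defining property of the conditional expectation, with the past-measurable
    \<open>?F\<close> as test function.\<close>
  also have "\<dots> = (\<integral>\<^sup>+ e. ?F e * nn_cond_exp P (past P n) ?G e \<partial>P)"
    by (rule nn_cond_exp_intg[OF F G, symmetric])
  also have "\<dots> \<le> (\<integral>\<^sup>+ e. ?F e * ?c \<partial>P)"
  proof (rule nn_integral_mono_AE)
    have "AE e in P. nn_cond_exp P (past P n) ?G e \<le> ?c"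
      using P Suc.prems by (simp add: admissible_def)
    then show "AE e in P. ?F e * nn_cond_exp P (past P n) ?G e \<le> ?F e * ?c"
      by eventually_elim (rule mult_left_mono, auto)
  qed
  also have "\<dots> = (\<integral>\<^sup>+ e. ?F e \<partial>P) * ?c"
    by (rule nn_integral_multc) (rule measurable_from_subalg[OF sub F])
  also have "\<dots> \<le> ennreal (exp (s\<^sup>2 / 2 * (\<Sum>k<n. (norm (a k))\<^sup>2))) * ?c"
    using Suc by (intro mult_right_mono) auto
  also have "\<dots> = ennreal (exp (s\<^sup>2 / 2 * (\<Sum>k<Suc n. (norm (a k))\<^sup>2)))"
    by (simp add: ennreal_mult[symmetric] exp_add[symmetric] algebra_simps)
  finally show ?case .
qed

text \<open>Markov's inequality for the exponential of \<open>l\<close> times the linear form. The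
  parameter \<open>l\<close> stays free, so that it can be optimized once the norms of the net
  directions are known.\<close>

lemma admissible_tail:
  fixes P :: "(nat \<Rightarrow> 'a::euclidean_space) measure"
  assumes P: "P \<in> admissible N s" and l: "l \<ge> 0"
  shows "emeasure P {e \<in> space P. (\<Sum>k<N. a k \<bullet> e k) \<ge> c}
    \<le> ennreal (exp (l\<^sup>2 * (s\<^sup>2 / 2) * (\<Sum>k<N. (norm (a k))\<^sup>2) - l * c))"
proof -
  have sets_P: "sets P = sets (path_space N)" using P by (simp add: admissible_def)
  note meas_P = borel_measurable_coordinate[OF sets_P]
  have Y [measurable]: "(\<lambda>e. \<Sum>k<N. a k \<bullet> e k) \<in> borel_measurable P"
    using meas_P by (intro borel_measurable_sum borel_measurable_inner borel_measurable_const) auto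
  let ?u = "\<lambda>e. ennreal (exp (\<Sum>k<N. (l *\<^sub>R a k) \<bullet> e k))"
  have u: "?u e = ennreal (exp (l * (\<Sum>k<N. a k \<bullet> e k)))" for e
    by (simp add: sum_distrib_left)
  have "emeasure P {e \<in> space P. (\<Sum>k<N. a k \<bullet> e k) \<ge> c}
    \<le> emeasure P {e \<in> space P. 1 \<le> ennreal (exp (- l * c)) * ?u e}"
  proof (rule emeasure_mono)
    show "{e \<in> space P. 1 \<le> ennreal (exp (- l * c)) * ?u e} \<in> sets P"
      unfolding u by measurable
    show "{e \<in> space P. (\<Sum>k<N. a k \<bullet> e k) \<ge> c}
        \<subseteq> {e \<in> space P. 1 \<le> ennreal (exp (- l * c)) * ?u e}"
      unfolding u using l
      by (auto simp: ennreal_mult[symmetric] exp_add[symmetric] mult_left_mono)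
  qed
  also have "\<dots> \<le> ennreal (exp (- l * c)) * (\<integral>\<^sup>+ e. ?u e * indicator (space P) e \<partial>P)"
  proof -
    have "?u \<in> borel_measurable P" unfolding u by measurable
    then show ?thesis
      using nn_integral_Markov_inequality[of ?u "space P" P "ennreal (exp (- l * c))"]
      by simp
  qed
  also have "(\<integral>\<^sup>+ e. ?u e * indicator (space P) e \<partial>P) = (\<integral>\<^sup>+ e. ?u e \<partial>P)"
    by (intro nn_integral_cong) auto
  also have "\<dots> \<le> ennreal (exp (s\<^sup>2 / 2 * (\<Sum>k<N. (norm (l *\<^sub>R a k))\<^sup>2)))"
    by (rule admissible_exp_moment[OF P order_refl])
  also have "ennreal (exp (- l * c)) * \<dots>
     = ennreal (exp (l\<^sup>2 * (s\<^sup>2 / 2) * (\<Sum>k<N. (norm (a k))\<^sup>2) - l * c))"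
    by (simp add: ennreal_mult[symmetric] exp_add[symmetric] power_mult_distrib
        sum_distrib_left algebra_simps)
  finally show ?thesis by (simp add: mult_left_mono)
qed

text \<open>A union bound over the half-spaces given by the net. The constant \<open>C\<close>
  counts net directions and is fixed before \<open>s\<close> and \<open>P\<close>, so it disappears
  after multiplying the logarithm by \<open>s\<^sup>2\<close>.\<close>

lemma admissible_path_norm_tail:
  fixes T \<delta> :: real
  assumes T: "T > 0" and \<delta>: "0 < \<delta>" "\<delta> \<le> 1"
  obtains C :: real where "C > 0"
    and "\<And>s (P :: (nat \<Rightarrow> 'a::euclidean_space) measure). s > 0 \<Longrightarrow> P \<in> admissible N s \<Longrightarrow>
      emeasure P {e \<in> space P. path_norm N e \<ge> T}
        \<le> ennreal (C * exp (- (1 - \<delta>) * T\<^sup>2 / (2 * s\<^sup>2)))"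
proof -
  \<comment> \<open>With \<open>l = T / s\<^sup>2\<close> the Chernoff exponent is
    \<open>T\<^sup>2 / (2 * s\<^sup>2)\<close> times \<open>(1 + 3 * N * \<eta>) - 2 * (1 - N *
    \<eta>) = 5 * N * \<eta> - 1\<close>, which explains the 5. Adding 1 to \<open>N\<close> keeps
    the denominator positive for \<open>N = 0\<close>.\<close>
  define \<eta> where "\<eta> = \<delta> / (5 * (real N + 1))"
  have \<eta>: "0 < \<eta>" "\<eta> \<le> 1" "5 * (N * \<eta>) \<le> \<delta>"
    using \<delta> by (auto simp: \<eta>_def field_simps)
  obtain D :: "'a set" where D: "finite D" and net: "\<And>u. norm u \<le> 1 \<Longrightarrow> \<exists>d\<in>D. norm (u - d) < \<eta>"
    using finite_net_cball[OF \<eta>(1)] by blast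
  define A where "A = {a \<in> (\<Pi>\<^sub>E k\<in>{..<N}. D). (\<Sum>k<N. (norm (a k))\<^sup>2) \<le> 1 + 3 * real N * \<eta>}"
  have "finite (\<Pi>\<^sub>E k\<in>{..<N}. D)" using D by (intro finite_PiE) auto
  then have A: "finite A" by (simp add: A_def)
  define c where "c = (1 - real N * \<eta>) * T"
  have "emeasure P {e \<in> space P. path_norm N e \<ge> T}
        \<le> ennreal ((card A + 1) * exp (- (1 - \<delta>) * T\<^sup>2 / (2 * s\<^sup>2)))"
    if s: "s > 0" and P: "P \<in> admissible N s" for s and P :: "(nat \<Rightarrow> 'a) measure"
  proof -
    let ?B = "\<lambda>a. {e \<in> space P. (\<Sum>k<N. a k \<bullet> e k) \<ge> c}"
    have sets_P: "sets P = sets (path_space N)" using P by (simp add: admissible_def)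
    note meas_P = borel_measurable_coordinate[OF sets_P]
    have [measurable]: "(\<lambda>e. \<Sum>k<N. a k \<bullet> e k) \<in> borel_measurable P" for a
      using meas_P by (intro borel_measurable_sum borel_measurable_inner borel_measurable_const) auto
    have B: "?B a \<in> sets P" for a by measurable
    have "{e \<in> space P. path_norm N e \<ge> T} \<subseteq> (\<Union>a\<in>A. ?B a)"
    proof safe
      fix e assume e: "e \<in> space P" "T \<le> path_norm N e"
      obtain a where a: "a \<in> (\<Pi>\<^sub>E k\<in>{..<N}. D)"
        "(\<Sum>k<N. a k \<bullet> e k) \<ge> (1 - real N * \<eta>) * path_norm N e"
        "(\<Sum>k<N. (norm (a k))\<^sup>2) \<le> 1 + 3 * real N * \<eta>"
        using net_direction[OF net, of N e] \<eta> e T by auto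
      have "c \<le> (1 - real N * \<eta>) * path_norm N e"
        unfolding c_def using e \<eta> \<delta> by (intro mult_left_mono) auto
      then show "e \<in> (\<Union>a\<in>A. ?B a)" using a e by (auto simp: A_def intro!: bexI[of _ a])
    qed
    then have "emeasure P {e \<in> space P. path_norm N e \<ge> T} \<le> emeasure P (\<Union>a\<in>A. ?B a)"
      using A B by (intro emeasure_mono sets.finite_UN) auto
    also have "\<dots> \<le> (\<Sum>a\<in>A. emeasure P (?B a))"
      using A B by (intro emeasure_subadditive_finite) auto
    also have "\<dots> \<le> (\<Sum>a\<in>A. ennreal (exp (- (1 - \<delta>) * T\<^sup>2 / (2 * s\<^sup>2))))"
    proof (rule sum_mono)
      fix a assume a: "a \<in> A"
      \<comment> \<open>the minimizer of \<open>l\<^sup>2 * s\<^sup>2 / 2 - l * T\<close>\<close>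
      define l where "l = T / s\<^sup>2"
      have "emeasure P (?B a) \<le> ennreal (exp (l\<^sup>2 * (s\<^sup>2 / 2) * (\<Sum>k<N. (norm (a k))\<^sup>2) - l * c))"
        using T s by (intro admissible_tail[OF P]) (auto simp: l_def)
      also have "l\<^sup>2 * (s\<^sup>2 / 2) * (\<Sum>k<N. (norm (a k))\<^sup>2) - l * c
          \<le> l\<^sup>2 * (s\<^sup>2 / 2) * (1 + 3 * real N * \<eta>) - l * c"
        using a by (intro diff_right_mono mult_left_mono) (auto simp: A_def)
      also have "\<dots> = T\<^sup>2 / (2 * s\<^sup>2) * (5 * (N * \<eta>) - 1)"
        using s by (simp add: l_def c_def field_simps power2_eq_square)
      also have "\<dots> \<le> T\<^sup>2 / (2 * s\<^sup>2) * (\<delta> - 1)"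
        using \<eta> by (intro mult_left_mono) auto
      also have "\<dots> = - (1 - \<delta>) * T\<^sup>2 / (2 * s\<^sup>2)" by (simp add: field_simps)
      finally show "emeasure P (?B a) \<le> ennreal (exp (- (1 - \<delta>) * T\<^sup>2 / (2 * s\<^sup>2)))"
        by (simp add: ennreal_leI)
    qed
    also have "\<dots> = ennreal (card A * exp (- (1 - \<delta>) * T\<^sup>2 / (2 * s\<^sup>2)))"
      by (simp add: ennreal_mult ennreal_of_nat_eq_real_of_nat)
    \<comment> \<open>The extra 1 makes the constant positive even if \<open>A\<close> is empty; its
      logarithm is taken later.\<close>
    also have "\<dots> \<le> ennreal ((card A + 1) * exp (- (1 - \<delta>) * T\<^sup>2 / (2 * s\<^sup>2)))"
      by (intro ennreal_leI mult_right_mono) auto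
    finally show ?thesis .
  qed
  then show thesis by (intro that[of "card A + 1"]) auto
qed

section \<open>Admissible laws with an atom\<close>

lemma cosh_minus_one_le:
  fixes b :: real
  assumes "b \<ge> 0"
  shows "cosh b - 1 \<le> b\<^sup>2 / 2 * exp b"
proof -
  \<comment> \<open>Since \<open>cosh b - 1\<close> is twice the square of
    \<open>sinh (b / 2)\<close>, it suffices to bound \<open>sinh (b / 2)\<close> linearly in
    \<open>b\<close>, up to an exponential factor.\<close>
  have "1 - exp (- b) \<le> b" using exp_ge_add_one_self[of "- b"] by simp
  then have "exp (b / 2) * (1 - exp (- b)) / 2 \<le> exp (b / 2) * b / 2"
    by (intro divide_right_mono mult_left_mono) auto
  moreover have "exp (b / 2) * (1 - exp (- b)) / 2 = sinh (b / 2)"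
    by (simp add: sinh_field_def right_diff_distrib exp_add[symmetric])
  ultimately have "sinh (b / 2) \<le> exp (b / 2) * b / 2" by simp
  then have "(sinh (b / 2))\<^sup>2 \<le> (exp (b / 2) * b / 2)\<^sup>2"
    using assms by (intro power_mono) auto
  also have "\<dots> = b\<^sup>2 / 4 * exp b"
    by (simp add: power_mult_distrib power_divide exp_double[symmetric])
  finally have "2 * (sinh (b / 2))\<^sup>2 \<le> b\<^sup>2 / 2 * exp b" by simp
  moreover have "cosh b = 1 + 2 * (sinh (b / 2))\<^sup>2"
    using cosh_double[of "b / 2"] cosh_square_eq[of "b / 2"] by simp
  ultimately show ?thesis by simp
qed

text \<open>With \<open>p = exp (- (1 + \<delta>) / (2 * \<sigma>\<^sup>2))\<close>, the left-hand
  side is the moment generating function of the law with mass \<open>p\<close> at 1 and at -1 and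
  the rest at 0. The Chernoff bound allows no atom at 1 heavier than
  \<open>exp (- 1 / (2 * \<sigma>\<^sup>2))\<close>, so the exponent is optimal up to
  \<open>\<delta>\<close>.\<close>

lemma eventually_three_point_subgaussian:
  fixes \<delta> :: real
  assumes "\<delta> > 0"
  shows "\<forall>\<^sub>F \<sigma> in at_right 0. 2 * exp (- (1 + \<delta>) / (2 * \<sigma>\<^sup>2)) \<le> 1 \<and>
    (\<forall>b. 1 + 2 * exp (- (1 + \<delta>) / (2 * \<sigma>\<^sup>2)) * (cosh b - 1) \<le> exp (\<sigma>\<^sup>2 * b\<^sup>2 / 2))"
proof -
  have "\<forall>\<^sub>F \<sigma>::real in at_right 0. exp (- 1 / (4 * \<sigma>\<^sup>2)) \<le> \<sigma>\<^sup>2 / 2" by real_asymp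
  moreover have "\<forall>\<^sub>F \<sigma>::real in at_right 0. exp (- 1 / (32 * \<sigma>\<^sup>2)) + exp (- \<delta> / (2 * \<sigma>\<^sup>2)) \<le> 1"
  proof -
    have "\<forall>\<^sub>F \<sigma>::real in at_right 0. exp (- 1 / (32 * \<sigma>\<^sup>2)) \<le> 1 / 2" by real_asymp
    moreover have "\<forall>\<^sub>F \<sigma>::real in at_right 0. exp (- \<delta> / (2 * \<sigma>\<^sup>2)) \<le> 1 / 2"
      using assms by real_asymp
    ultimately show ?thesis by eventually_elim simp
  qed
  moreover have "\<forall>\<^sub>F \<sigma>::real in at_right 0. 2 * exp (- (1 + \<delta>) / (2 * \<sigma>\<^sup>2)) \<le> 1"
    using assms by real_asymp
  moreover have "\<forall>\<^sub>F \<sigma>::real in at_right 0. \<sigma> > 0" by (rule eventually_at_right_less)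
  ultimately show ?thesis
  proof eventually_elim
    case (elim \<sigma>)
    define p where "p = exp (- (1 + \<delta>) / (2 * \<sigma>\<^sup>2))"
    have main: "1 + 2 * p * (cosh b - 1) \<le> exp (\<sigma>\<^sup>2 * b\<^sup>2 / 2)" if b: "b \<ge> 0" for b
    \<comment> \<open>The cutoff is half of \<open>1 / (2 * \<sigma>\<^sup>2)\<close>. Below it
      \<open>p * exp b\<close> is still exponentially small, so a second-order bound suffices; above
      it \<open>\<sigma>\<^sup>2 * b\<^sup>2 / 2\<close> is at least
      \<open>1 / (32 * \<sigma>\<^sup>2)\<close>, hence large.\<close>
    proof (cases "b \<le> 1 / (4 * \<sigma>\<^sup>2)")
      case True
      have "p * exp b \<le> exp (- 1 / (4 * \<sigma>\<^sup>2))"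
      proof -
        have "- (1 + \<delta>) / (2 * \<sigma>\<^sup>2) \<le> - 1 / (2 * \<sigma>\<^sup>2)"
          using assms elim by (intro divide_right_mono) auto
        then have "- (1 + \<delta>) / (2 * \<sigma>\<^sup>2) + b \<le> - 1 / (4 * \<sigma>\<^sup>2)" using True by simp
        then show ?thesis by (simp add: p_def exp_add[symmetric])
      qed
      then have pb: "p * exp b \<le> \<sigma>\<^sup>2 / 2" using elim by simp
      have "2 * p * (cosh b - 1) \<le> 2 * p * (b\<^sup>2 / 2 * exp b)"
        using cosh_minus_one_le[OF b] by (intro mult_left_mono) (auto simp: p_def)
      also have "\<dots> = p * exp b * b\<^sup>2" by simp
      also have "\<dots> \<le> \<sigma>\<^sup>2 / 2 * b\<^sup>2" using pb by (intro mult_right_mono) auto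
      finally show ?thesis using exp_ge_add_one_self[of "\<sigma>\<^sup>2 * b\<^sup>2 / 2"] by linarith
    next
      case False
      \<comment> \<open>AM-GM bounds \<open>p * exp b\<close>; the slack \<open>exp (- \<delta> / (2 * \<sigma>\<^sup>2))\<close> then absorbs the summand \<open>1\<close>,
        because \<open>b\<close> is large.\<close>
      let ?E = "exp (\<sigma>\<^sup>2 * b\<^sup>2 / 2)"
      have "0 \<le> (\<sigma> * b - 1 / \<sigma>)\<^sup>2" by simp
      then have "b \<le> \<sigma>\<^sup>2 * b\<^sup>2 / 2 + 1 / (2 * \<sigma>\<^sup>2)"
        using elim by (simp add: power2_eq_square field_simps)
      then have "- (1 + \<delta>) / (2 * \<sigma>\<^sup>2) + b \<le> \<sigma>\<^sup>2 * b\<^sup>2 / 2 + - \<delta> / (2 * \<sigma>\<^sup>2)"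
        by (simp add: add_divide_distrib diff_divide_distrib)
      then have pb: "p * exp b \<le> ?E * exp (- \<delta> / (2 * \<sigma>\<^sup>2))"
        by (simp add: p_def exp_add[symmetric])
      have "(1 / (4 * \<sigma>\<^sup>2))\<^sup>2 \<le> b\<^sup>2" using False by (intro power_mono) auto
      then have "\<sigma>\<^sup>2 / 2 * (1 / (4 * \<sigma>\<^sup>2))\<^sup>2 \<le> \<sigma>\<^sup>2 / 2 * b\<^sup>2" by (intro mult_left_mono) auto
      then have "1 / (32 * \<sigma>\<^sup>2) \<le> \<sigma>\<^sup>2 * b\<^sup>2 / 2"
        using elim by (simp add: power2_eq_square field_simps)
      then have "exp (- (\<sigma>\<^sup>2 * b\<^sup>2 / 2)) \<le> exp (- 1 / (32 * \<sigma>\<^sup>2))" by simp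
      then have "exp (- (\<sigma>\<^sup>2 * b\<^sup>2 / 2)) + exp (- \<delta> / (2 * \<sigma>\<^sup>2)) \<le> 1" using elim by linarith
      then have "?E * (exp (- (\<sigma>\<^sup>2 * b\<^sup>2 / 2)) + exp (- \<delta> / (2 * \<sigma>\<^sup>2))) \<le> ?E * 1"
        by (intro mult_left_mono) auto
      then have "1 + ?E * exp (- \<delta> / (2 * \<sigma>\<^sup>2)) \<le> ?E"
        by (simp add: distrib_left exp_add[symmetric] del: exp_le_cancel_iff)
      moreover have "2 * p * (cosh b - 1) \<le> p * exp b"
      proof -
        have "exp (- b) \<le> 1" using b by simp
        then have "exp (- b) \<le> 2" by linarith
        then have "2 * (cosh b - 1) \<le> exp b" by (simp add: cosh_field_def field_simps)
        from mult_left_mono[OF this, of p] show ?thesis by (simp add: p_def mult_ac)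
      qed
      ultimately show ?thesis using pb by linarith
    qed
    have "1 + 2 * p * (cosh b - 1) \<le> exp (\<sigma>\<^sup>2 * b\<^sup>2 / 2)" for b
      using main[of "\<bar>b\<bar>"] by (cases "b \<ge> 0") auto
    then show ?case using elim by (simp add: p_def)
  qed
qed

lemma nn_integral_bernoulli_ennreal:
  fixes f :: "bool \<Rightarrow> real"
  assumes "0 \<le> p" "p \<le> 1" "\<And>c. 0 \<le> f c"
  shows "(\<integral>\<^sup>+ c. ennreal (f c) \<partial>bernoulli_pmf p) = ennreal (f True * p + f False * (1 - p))"
  using assms by (simp add: ennreal_mult)

text \<open>For \<open>v \<noteq> 0\<close> the three-point law is transported to the line through
  \<open>v\<close>, with \<open>\<sigma> = s / norm v\<close> and \<open>b = a \<bullet> v\<close>;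
  Cauchy-Schwarz then handles all directions \<open>a\<close>. For \<open>v = 0\<close> a point mass
  at 0 does.\<close>

lemma eventually_atomic_law:
  fixes v :: "'a::euclidean_space" and \<delta> :: real
  assumes "\<delta> > 0"
  shows "\<forall>\<^sub>F s in at_right 0. \<exists>M. prob_space M \<and> sets M = sets borel \<and>
    (\<forall>a. (\<integral>\<^sup>+ x. ennreal (exp (a \<bullet> x)) \<partial>M) \<le> ennreal (exp (s\<^sup>2 * (norm a)\<^sup>2 / 2))) \<and>
    ennreal (exp (- (1 + \<delta>) * (norm v)\<^sup>2 / (2 * s\<^sup>2))) \<le> emeasure M {v}"
proof (cases "v = 0")
  case True
  have "prob_space (return borel (0::'a))" by (rule prob_space_return) simp
  then show ?thesis
    using True
    by (intro always_eventually allI exI[of _ "return borel (0::'a)"])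
       (auto simp: nn_integral_return)
next
  case False
  have "filterlim (\<lambda>s. s / norm v) (at_right 0) (at_right 0)"
    using False by real_asymp
  from eventually_compose_filterlim[OF eventually_three_point_subgaussian[OF assms] this]
  have "\<forall>\<^sub>F s in at_right 0. 2 * exp (- (1 + \<delta>) / (2 * (s / norm v)\<^sup>2)) \<le> 1 \<and>
    (\<forall>b. 1 + 2 * exp (- (1 + \<delta>) / (2 * (s / norm v)\<^sup>2)) * (cosh b - 1)
          \<le> exp ((s / norm v)\<^sup>2 * b\<^sup>2 / 2))" .
  then show ?thesis
  proof eventually_elim
    case (elim s)
    define p where "p = exp (- (1 + \<delta>) / (2 * (s / norm v)\<^sup>2))"
    have p: "0 \<le> p" "2 * p \<le> 1" using elim by (auto simp: p_def)
    \<comment> \<open>The first coin decides whether the noise is nonzero, the second one its sign,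
      so \<open>v\<close> and \<open>- v\<close> get mass \<open>p\<close> each.\<close>
    define B where "B = pair_pmf (bernoulli_pmf (2 * p)) (bernoulli_pmf (1 / 2))"
    define h where "h = (\<lambda>(b, c). if b then (if c then v else - v) else 0)"
    define M where "M = distr (measure_pmf B) borel h"
    have "prob_space M"
      unfolding M_def by (rule prob_space.prob_space_distr) (auto intro: prob_space_measure_pmf)
    moreover have "sets M = sets borel" by (simp add: M_def)
    moreover have "(\<integral>\<^sup>+ x. ennreal (exp (a \<bullet> x)) \<partial>M) \<le> ennreal (exp (s\<^sup>2 * (norm a)\<^sup>2 / 2))" for a
    proof -
      have "(\<integral>\<^sup>+ x. ennreal (exp (a \<bullet> x)) \<partial>M) = (\<integral>\<^sup>+ y. ennreal (exp (a \<bullet> h y)) \<partial>measure_pmf B)"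
        unfolding M_def by (rule nn_integral_distr) auto
      also have "\<dots> = ennreal (1 + 2 * p * (cosh (a \<bullet> v) - 1))"
      proof -
        have half: "(\<integral>\<^sup>+ c. ennreal (exp (a \<bullet> h (b, c))) \<partial>bernoulli_pmf (1 / 2))
            = ennreal (if b then cosh (a \<bullet> v) else 1)" for b
          by (subst nn_integral_bernoulli_ennreal) (auto simp: h_def cosh_def field_simps)
        have "(\<integral>\<^sup>+ y. ennreal (exp (a \<bullet> h y)) \<partial>measure_pmf B)
            = ennreal (cosh (a \<bullet> v) * (2 * p) + (1 - 2 * p))"
          unfolding B_def nn_integral_pair_pmf' half using p
          by (subst nn_integral_bernoulli_ennreal) (auto simp: cosh_real_nonneg)
        also have "cosh (a \<bullet> v) * (2 * p) + (1 - 2 * p) = 1 + 2 * p * (cosh (a \<bullet> v) - 1)"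
          by (simp add: algebra_simps)
        finally show ?thesis .
      qed
      also have "\<dots> \<le> ennreal (exp ((s / norm v)\<^sup>2 * (a \<bullet> v)\<^sup>2 / 2))"
        using elim by (intro ennreal_leI) (simp add: p_def)
      also have "\<dots> \<le> ennreal (exp (s\<^sup>2 * (norm a)\<^sup>2 / 2))"
      proof -
        have "\<bar>a \<bullet> v\<bar>\<^sup>2 \<le> (norm a * norm v)\<^sup>2"
          by (intro power_mono Cauchy_Schwarz_ineq2) auto
        then have "(s / norm v)\<^sup>2 * (a \<bullet> v)\<^sup>2 \<le> (s / norm v)\<^sup>2 * (norm a * norm v)\<^sup>2"
          by (intro mult_left_mono) auto
        also have "\<dots> = s\<^sup>2 * (norm a)\<^sup>2"
          using False by (simp add: power_mult_distrib power_divide)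
        finally show ?thesis by (intro ennreal_leI) simp
      qed
      finally show ?thesis .
    qed
    moreover have "ennreal (exp (- (1 + \<delta>) * (norm v)\<^sup>2 / (2 * s\<^sup>2))) \<le> emeasure M {v}"
    proof -
      have "ennreal (exp (- (1 + \<delta>) * (norm v)\<^sup>2 / (2 * s\<^sup>2))) = ennreal p"
        by (simp add: p_def power_divide)
      also have "\<dots> = emeasure (measure_pmf B) {(True, True)}"
        using p by (simp add: B_def emeasure_pmf_single pmf_pair)
      also have "\<dots> \<le> emeasure (measure_pmf B) (h -` {v} \<inter> space (measure_pmf B))"
        by (rule emeasure_mono) (auto simp: h_def)
      also have "\<dots> = emeasure M {v}"
        unfolding M_def by (rule emeasure_distr[symmetric]) auto
      finally show ?thesis .
    qed
    ultimately show ?case by blast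
  qed
qed

section \<open>Product laws and their atoms\<close>

lemma past_set_determined:
  fixes P :: "(nat \<Rightarrow> 'a::euclidean_space) measure"
  assumes "A \<in> sets (past P k)" and "e \<in> space P" "e' \<in> space P" and "\<And>i. i < k \<Longrightarrow> e i = e' i"
  shows "e \<in> A \<longleftrightarrow> e' \<in> A"
  using assms(1) unfolding sets_past
  by induction (use assms(2-4) in auto)

text \<open>Under a product law \<open>e k\<close> is independent of the past, so its conditional
  exponential moment is almost everywhere the constant \<open>?c\<close>, the unconditional moment
  under \<open>M k\<close>.\<close>

lemma PiM_admissible:
  fixes M :: "nat \<Rightarrow> 'a::euclidean_space measure"
  assumes prob: "\<And>k. prob_space (M k)" and sets_M: "\<And>k. sets (M k) = sets borel"
    and mgf: "\<And>k a. (\<integral>\<^sup>+ x. ennreal (exp (a \<bullet> x)) \<partial>M k) \<le> ennreal (exp (s\<^sup>2 * (norm a)\<^sup>2 / 2))"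
  shows "PiM {..<N} M \<in> admissible N s"
proof -
  let ?P = "PiM {..<N} M"
  interpret product_prob_space M "{..<N}"
    by (simp add: product_prob_space_def product_prob_space_axioms_def product_sigma_finite_def
      prob prob_space_imp_sigma_finite)
  have sets_P: "sets ?P = sets (path_space N)"
    by (intro sets_PiM_cong refl) (simp add: sets_M)
  have space_M: "space (M k) = UNIV" for k using sets_eq_imp_space_eq[OF sets_M[of k]] by simp
  have "AE e in ?P. nn_cond_exp ?P (past ?P k) (\<lambda>e. ennreal (exp (a \<bullet> e k))) e
          \<le> ennreal (exp (s\<^sup>2 * (norm a)\<^sup>2 / 2))" if k: "k < N" for a k
  proof -
    have sub: "subalgebra ?P (past ?P k)" using subalgebra_past[OF sets_P] k by simp
    interpret F: sigma_finite_subalgebra ?P "past ?P k"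
      by (intro finite_measure_subalgebra_is_sigma_finite finite_measure_subalgebra.intro
        finite_measure_subalgebra_axioms.intro sub P.finite_measure_axioms)
    let ?I = "{..<N} - {k}" and ?h = "\<lambda>x. ennreal (exp (a \<bullet> x))"
    let ?c = "\<integral>\<^sup>+ x. ?h x \<partial>M k"
    have I: "insert k ?I = {..<N}" using k by auto
    have h [measurable]: "?h \<in> borel_measurable (M k)"
      unfolding measurable_cong_sets[OF sets_M refl] by measurable
    have ek [measurable]: "(\<lambda>e. e k) \<in> measurable ?P (M k)"
      using k by (intro measurable_component_singleton) auto
    have hk [measurable]: "(\<lambda>e. ?h (e k)) \<in> borel_measurable ?P"
      by (rule measurable_compose[OF ek h])
    \<comment> \<open>Independence in integrated form: Fubini splits off coordinate
      \<open>k\<close>, and an event of the past does not see that coordinate, so the dummy value 0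
      can be put there.\<close>
    have fact: "(\<integral>\<^sup>+ e\<in>A. g (e k) \<partial>?P)
        = (\<integral>\<^sup>+ x. g x \<partial>M k) * (\<integral>\<^sup>+ x. indicator A (x(k := 0)) \<partial>PiM ?I M)"
      if A: "A \<in> sets (past ?P k)" and g [measurable]: "g \<in> borel_measurable (M k)"
      for A and g :: "'a \<Rightarrow> ennreal"
    proof -
      have [measurable]: "A \<in> sets ?P" using A sub by (auto simp: subalgebra_def)
      have "(\<integral>\<^sup>+ e\<in>A. g (e k) \<partial>?P)
          = (\<integral>\<^sup>+ x. (\<integral>\<^sup>+ y. g ((x(k := y)) k) * indicator A (x(k := y)) \<partial>M k) \<partial>PiM ?I M)"
      proof -
        have "(\<lambda>e. g (e k) * indicator A e) \<in> borel_measurable (PiM (insert k ?I) M)"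
          unfolding I by measurable
        from product_nn_integral_insert[OF _ _ this] show ?thesis unfolding I by simp
      qed
      also have "\<dots> = (\<integral>\<^sup>+ x. (\<integral>\<^sup>+ y. g y \<partial>M k) * indicator A (x(k := 0)) \<partial>PiM ?I M)"
      proof (rule nn_integral_cong)
        fix x assume x: "x \<in> space (PiM ?I M)"
        have upd: "x(k := y) \<in> space ?P" for y
          using x k by (auto simp: space_PiM PiE_iff extensional_def space_M)
        have const: "indicator A (x(k := y)) = (indicator A (x(k := 0)) :: ennreal)" for y
          using past_set_determined[OF A upd[of y] upd[of 0]] by (simp add: indicator_def)
        then have "(\<integral>\<^sup>+ y. g ((x(k := y)) k) * indicator A (x(k := y)) \<partial>M k)
            = (\<integral>\<^sup>+ y. g y * indicator A (x(k := 0)) \<partial>M k)"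
          by (subst const) simp
        also have "\<dots> = (\<integral>\<^sup>+ y. g y \<partial>M k) * indicator A (x(k := 0))"
          by (rule nn_integral_multc) measurable
        finally show "(\<integral>\<^sup>+ y. g ((x(k := y)) k) * indicator A (x(k := y)) \<partial>M k)
            = (\<integral>\<^sup>+ y. g y \<partial>M k) * indicator A (x(k := 0))" .
      qed
      also have "\<dots> = (\<integral>\<^sup>+ x. g x \<partial>M k) * (\<integral>\<^sup>+ x. indicator A (x(k := 0)) \<partial>PiM ?I M)"
      proof (rule nn_integral_cmult)
        have "(\<lambda>x. x(k := 0)) \<in> measurable (PiM ?I M) (PiM (insert k ?I) M)"
          by (intro measurable_fun_upd[where J = ?I]) (auto simp: space_M)
        then have "(\<lambda>x. x(k := 0)) \<in> measurable (PiM ?I M) ?P" unfolding I .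
        then show "(\<lambda>x. indicator A (x(k := 0)) :: ennreal) \<in> borel_measurable (PiM ?I M)"
          by measurable
      qed
      finally show ?thesis .
    qed
    \<comment> \<open>Uniqueness of the conditional expectation: \<open>fact\<close> is used with
      \<open>?h\<close> for one side and with the constant 1, which yields the mass of
      \<open>A\<close>, for the other.\<close>
    have "AE e in ?P. ?c = nn_cond_exp ?P (past ?P k) (\<lambda>e. ?h (e k)) e"
    proof (rule F.nn_cond_exp_charact)
      fix A assume A: "A \<in> sets (past ?P k)"
      have "(\<integral>\<^sup>+ e\<in>A. ?c \<partial>?P) = ?c * (\<integral>\<^sup>+ e\<in>A. 1 \<partial>?P)"
        using A sub by (subst nn_integral_cmult[symmetric]) (auto simp: subalgebra_def)
      also have "(\<integral>\<^sup>+ e\<in>A. 1 \<partial>?P) = (\<integral>\<^sup>+ x. indicator A (x(k := 0)) \<partial>PiM ?I M)"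
        using fact[OF A, of "\<lambda>_. 1"] by (simp add: M.emeasure_space_1)
      finally show "(\<integral>\<^sup>+ e\<in>A. ?h (e k) \<partial>?P) = (\<integral>\<^sup>+ e\<in>A. ?c \<partial>?P)"
        using fact[OF A h] by simp
    qed (use hk in auto)
    then show ?thesis
      by eventually_elim (use mgf[of k a] in simp)
  qed
  then show ?thesis
    using sets_P P.prob_space_axioms by (simp add: admissible_def)
qed

text \<open>Only finitely many coordinates occur, so all one-step laws exist for the same small
  \<open>s\<close>. In their product the atom masses multiply and the squared block norms add up to
  that of the path.\<close>

lemma eventually_admissible_atom:
  fixes v :: "nat \<Rightarrow> 'a::euclidean_space"
  assumes \<delta>: "\<delta> > 0" and v: "v \<in> space (path_space N)"
  shows "\<forall>\<^sub>F s in at_right 0. \<exists>P \<in> admissible N s.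
    ennreal (exp (- (1 + \<delta>) * (path_norm N v)\<^sup>2 / (2 * s\<^sup>2))) \<le> emeasure P {v}"
proof -
  have "\<forall>\<^sub>F s in at_right 0. \<forall>k\<in>{..<N}. \<exists>M. prob_space M \<and> sets M = sets borel \<and>
    (\<forall>a. (\<integral>\<^sup>+ x. ennreal (exp (a \<bullet> x)) \<partial>M) \<le> ennreal (exp (s\<^sup>2 * (norm a)\<^sup>2 / 2))) \<and>
    ennreal (exp (- (1 + \<delta>) * (norm (v k))\<^sup>2 / (2 * s\<^sup>2))) \<le> emeasure M {v k}"
    by (intro eventually_ball_finite ballI eventually_atomic_law \<delta>) auto
  then show ?thesis
  proof eventually_elim
    case (elim s)
    then obtain M where M: "\<And>k. k < N \<Longrightarrow> prob_space (M k) \<and> sets (M k) = sets borel \<and>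
      (\<forall>a. (\<integral>\<^sup>+ x. ennreal (exp (a \<bullet> x)) \<partial>M k) \<le> ennreal (exp (s\<^sup>2 * (norm a)\<^sup>2 / 2))) \<and>
      ennreal (exp (- (1 + \<delta>) * (norm (v k))\<^sup>2 / (2 * s\<^sup>2))) \<le> emeasure (M k) {v k}"
      unfolding lessThan_iff Ball_def by metis
    \<comment> \<open>\<open>PiM_admissible\<close> asks for a law at every index; from
      \<open>N\<close> on a point mass fills in.\<close>
    define M' where "M' k = (if k < N then M k else return borel 0)" for k
    have prob: "prob_space (M' k)" for k
      using M[of k] by (auto simp: M'_def intro: prob_space_return)
    have sets_M': "sets (M' k) = sets borel" for k
      using M[of k] by (auto simp: M'_def)
    have mgf: "(\<integral>\<^sup>+ x. ennreal (exp (a \<bullet> x)) \<partial>M' k) \<le> ennreal (exp (s\<^sup>2 * (norm a)\<^sup>2 / 2))" for a k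
      using M[of k] by (auto simp: M'_def nn_integral_return)
    interpret product_prob_space M' "{..<N}"
      by (simp add: product_prob_space_def product_prob_space_axioms_def product_sigma_finite_def
        prob prob_space_imp_sigma_finite)
    \<comment> \<open>This holds because points of the path space are \<open>undefined\<close>
      outside \<open>{..<N}\<close>.\<close>
    have "{v} = (\<Pi>\<^sub>E k\<in>{..<N}. {v k})"
      using v by (subst PiE_singleton) (auto simp: space_PiM PiE_iff)
    then have "emeasure (PiM {..<N} M') {v} = (\<Prod>k<N. emeasure (M' k) {v k})"
      by (simp add: emeasure_PiM sets_M')
    also have "\<dots> \<ge> (\<Prod>k<N. ennreal (exp (- (1 + \<delta>) * (norm (v k))\<^sup>2 / (2 * s\<^sup>2))))"
      using M by (intro prod_mono_ennreal) (auto simp: M'_def)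
    also have "(\<Prod>k<N. ennreal (exp (- (1 + \<delta>) * (norm (v k))\<^sup>2 / (2 * s\<^sup>2))))
        = ennreal (exp (- (1 + \<delta>) * (path_norm N v)\<^sup>2 / (2 * s\<^sup>2)))"
      by (simp add: prod_ennreal exp_sum[symmetric] path_norm_def sum_nonneg
        sum_distrib_left sum_divide_distrib)
    moreover have "PiM {..<N} M' \<in> admissible N s"
      by (rule PiM_admissible[OF prob sets_M' mgf])
    ultimately show ?case by auto
  qed
qed

section \<open>The failure exponent\<close>

lemma answer_measurable:
  fixes qry :: "nat \<Rightarrow> (nat \<Rightarrow> 'a) \<Rightarrow> 'a::euclidean_space"
  assumes qry: "\<And>k. k < N \<Longrightarrow> qry k \<in> borel_measurable (path_space k)"
    and g: "g \<in> borel_measurable borel" and "k < N"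
  shows "(\<lambda>e. answer qry g e k) \<in> borel_measurable (path_space N)"
  using \<open>k < N\<close>
proof (induction k rule: less_induct)
  case (less k)
  have "(\<lambda>e. \<lambda>i\<in>{..<k}. answer qry g e i) \<in> measurable (path_space N) (path_space k)"
    using less by (intro measurable_restrict) auto
  from measurable_compose[OF measurable_compose[OF this qry] g]
  have "(\<lambda>e. g (qry k (\<lambda>i\<in>{..<k}. answer qry g e i))) \<in> borel_measurable (path_space N)"
    using less.prems by simp
  moreover have "(\<lambda>e. e k) \<in> borel_measurable (path_space N)"
    using less.prems by (intro measurable_component_singleton) auto
  ultimately show ?case
    by (subst answer.simps) (rule borel_measurable_add)
qed

text \<open>A real-valued convex function on a Euclidean space is continuous, hence Borel.
  Measurability matters for the lower bound, since \<open>emeasure\<close> is 0 on nonmeasurable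
  sets.\<close>

lemma gap_measurable:
  assumes "algorithm N qry out" and "(f, g) \<in> instances x0 R L"
  shows "gap N qry out f g \<in> borel_measurable (path_space N)"
proof -
  have "convex_on UNIV f" and g: "g \<in> borel_measurable borel"
    using assms(2) by (auto simp: instances_def fclass_def)
  then have f: "f \<in> borel_measurable borel"
    by (intro borel_measurable_continuous_onI convex_on_continuous) auto
  have "(\<lambda>e. \<lambda>i\<in>{..<N}. answer qry g e i) \<in> measurable (path_space N) (path_space N)"
    using assms(1) g by (intro measurable_restrict answer_measurable) (auto simp: algorithm_def)
  moreover have "out \<in> borel_measurable (path_space N)"
    using assms(1) by (simp add: algorithm_def)
  ultimately have "(\<lambda>e. f (out (\<lambda>i\<in>{..<N}. answer qry g e i))) \<in> borel_measurable (path_space N)"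
    by (rule measurable_compose[OF measurable_compose f])
  then show ?thesis
    unfolding gap_def[abs_def] by simp
qed

text \<open>Every failing path competes in the infimum defining the threshold, so its norm is at
  least \<open>T\<close>, and the tail bound applies uniformly over instances and laws.\<close>

lemma failure_sup_upper:
  fixes x0 :: "'a::euclidean_space" and T \<delta> :: real
  assumes T: "T > 0" "threshold x0 R L N qry out \<epsilon> = ereal T" and \<delta>: "0 < \<delta>" "\<delta> \<le> 1"
  obtains C :: real where "C > 0" and "\<And>s. s > 0 \<Longrightarrow>
    failure_sup x0 R L N qry out \<epsilon> s \<le> ennreal (C * exp (- (1 - \<delta>) * T\<^sup>2 / (2 * s\<^sup>2)))"
proof -
  obtain C where C: "C > 0"
    and tail: "\<And>s (P :: (nat \<Rightarrow> 'a) measure). s > 0 \<Longrightarrow> P \<in> admissible N s \<Longrightarrow>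
      emeasure P {e \<in> space P. path_norm N e \<ge> T} \<le> ennreal (C * exp (- (1 - \<delta>) * T\<^sup>2 / (2 * s\<^sup>2)))"
    using admissible_path_norm_tail[OF T(1) \<delta>] by blast
  define B where "B s = ennreal (C * exp (- (1 - \<delta>) * T\<^sup>2 / (2 * s\<^sup>2)))" for s
  have "failure_sup x0 R L N qry out \<epsilon> s \<le> B s" if s: "s > 0" for s
    unfolding failure_sup_def
  proof (clarsimp intro!: SUP_least)
    fix f g and P :: "(nat \<Rightarrow> 'a) measure"
    assume fg: "(f, g) \<in> instances x0 R L" and P: "P \<in> admissible N s"
    have sets_P: "sets P = sets (path_space N)" using P by (simp add: admissible_def)
    have space_P: "space P = space (path_space N)" by (rule sets_eq_imp_space_eq[OF sets_P])
    have "T \<le> path_norm N e" if "e \<in> space P" "\<epsilon> \<le> gap N qry out f g e" for e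
    proof -
      have "threshold x0 R L N qry out \<epsilon> \<le> ereal (path_norm N e)"
        unfolding threshold_def using that fg space_P by (intro Inf_lower) auto
      then show ?thesis using T by simp
    qed
    moreover have "{e \<in> space P. path_norm N e \<ge> T} \<in> sets P"
    proof -
      have "path_norm N \<in> borel_measurable (path_space N :: (nat \<Rightarrow> 'a) measure)"
        unfolding path_norm_def[abs_def] by measurable
      then have [measurable]: "path_norm N \<in> borel_measurable P"
        using measurable_cong_sets[OF sets_P refl] by auto
      show ?thesis by measurable
    qed
    ultimately have "emeasure P {e \<in> space P. \<epsilon> \<le> gap N qry out f g e}
        \<le> emeasure P {e \<in> space P. path_norm N e \<ge> T}"
      by (intro emeasure_mono) auto
    also have "\<dots> \<le> B s" unfolding B_def by (rule tail[OF s P])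
    finally show "emeasure P {e \<in> space P. \<epsilon> \<le> gap N qry out f g e}
        \<le> B s" .
  qed
  then show thesis using C that unfolding B_def by blast
qed

text \<open>The infimum need not be attained, so a failing path of norm below
  \<open>T + \<delta>\<close> is taken together with its instance. Both stay fixed as
  \<open>s\<close> tends to 0, and the atom at this path is contained in the failure event.\<close>

lemma failure_sup_lower:
  fixes x0 :: "'a::euclidean_space" and T \<delta> :: real
  assumes alg: "algorithm N qry out"
    and T: "threshold x0 R L N qry out \<epsilon> = ereal T" and \<delta>: "0 < \<delta>"
  shows "\<forall>\<^sub>F s in at_right 0. ennreal (exp (- (1 + \<delta>) * (T + \<delta>)\<^sup>2 / (2 * s\<^sup>2)))
    \<le> failure_sup x0 R L N qry out \<epsilon> s"
proof -
  have "threshold x0 R L N qry out \<epsilon> < ereal (T + \<delta>)" using T \<delta> by simp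
  then obtain e f g where e: "e \<in> space (path_space N)" "path_norm N e < T + \<delta>"
    and fg: "(f, g) \<in> instances x0 R L" "gap N qry out f g e \<ge> \<epsilon>"
    unfolding threshold_def Inf_less_iff by auto
  from eventually_admissible_atom[OF \<delta> e(1)] eventually_at_right_less[of 0]
  show ?thesis
  proof eventually_elim
    case (elim s)
    then obtain P where P: "P \<in> admissible N s"
      and atom: "ennreal (exp (- (1 + \<delta>) * (path_norm N e)\<^sup>2 / (2 * s\<^sup>2))) \<le> emeasure P {e}" by blast
    have sets_P: "sets P = sets (path_space N)" using P by (simp add: admissible_def)
    have space_P: "space P = space (path_space N)" by (rule sets_eq_imp_space_eq[OF sets_P])
    have [measurable]: "gap N qry out f g \<in> borel_measurable P"
      using gap_measurable[OF alg fg(1)] measurable_cong_sets[OF sets_P refl] by auto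
    have fail: "{e \<in> space P. gap N qry out f g e \<ge> \<epsilon>} \<in> sets P" by measurable
    have "(1 + \<delta>) * (path_norm N e)\<^sup>2 \<le> (1 + \<delta>) * (T + \<delta>)\<^sup>2"
      using e \<delta> by (intro mult_left_mono power_mono) (auto simp: path_norm_nonneg)
    then have "ennreal (exp (- (1 + \<delta>) * (T + \<delta>)\<^sup>2 / (2 * s\<^sup>2)))
        \<le> ennreal (exp (- (1 + \<delta>) * (path_norm N e)\<^sup>2 / (2 * s\<^sup>2)))"
      by (intro ennreal_leI exp_le_cancel_iff[THEN iffD2] divide_right_mono)
        (simp_all only: mult_minus_left neg_le_iff_le, simp)
    also note atom
    also have "emeasure P {e} \<le> emeasure P {e \<in> space P. gap N qry out f g e \<ge> \<epsilon>}"
      using e fg space_P by (intro emeasure_mono fail) auto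
    also have "\<dots> \<le> failure_sup x0 R L N qry out \<epsilon> s"
      unfolding failure_sup_def
      by (rule SUP_upper2[OF fg(1)], simp, rule SUP_upper2[OF P], simp)
    finally show ?case .
  qed
qed

text \<open>The bounds keep \<open>p\<close> positive and finite, which avoids both the infinite
  branch of \<open>neg_log\<close> and the default value of \<open>enn2real\<close> at
  infinity.\<close>

lemma neg_log_real_bounds:
  assumes "ennreal x \<le> p" "p \<le> ennreal y" "x > 0"
  shows "neg_log p = ereal (- ln (enn2real p))" "- ln y \<le> - ln (enn2real p)"
    "- ln (enn2real p) \<le> - ln x"
proof -
  have fin: "p < \<top>" using assms(2) by (simp add: order_le_less_trans)
  have pos: "p \<noteq> 0" using assms by (auto simp: ennreal_eq_0_iff)
  then show "neg_log p = ereal (- ln (enn2real p))" by (simp add: neg_log_def)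
  have "enn2real (ennreal x) \<le> enn2real p" using assms fin by (intro enn2real_mono) auto
  then have x: "x \<le> enn2real p" using assms by simp
  have "y > 0" using assms pos by (metis ennreal_neg le_zero_eq not_le)
  then have "enn2real p \<le> y" using assms by (intro enn2real_leI) auto
  then show "- ln y \<le> - ln (enn2real p)" "- ln (enn2real p) \<le> - ln x"
    using x assms by auto
qed

theorem proposition3:
  fixes x0 :: "'a::euclidean_space" and R L \<epsilon> :: real and N :: nat
    and qry :: "nat \<Rightarrow> (nat \<Rightarrow> 'a) \<Rightarrow> 'a" and out :: "(nat \<Rightarrow> 'a) \<Rightarrow> 'a"
  assumes "R > 0" and "L > 0" and "N \<ge> 1"
    and "0 < \<epsilon>" and "\<epsilon> < R * L"
    and "algorithm N qry out"
    and "0 < threshold x0 R L N qry out \<epsilon>" and "threshold x0 R L N qry out \<epsilon> < \<infinity>"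
  shows "((\<lambda>s. ereal (s\<^sup>2) * failure_exponent x0 R L N qry out \<epsilon> s)
            \<longlongrightarrow> (threshold x0 R L N qry out \<epsilon>)\<^sup>2 / 2) (at_right 0)"
proof -
  obtain T where T: "threshold x0 R L N qry out \<epsilon> = ereal T" "T > 0"
    using assms(7,8) by (cases "threshold x0 R L N qry out \<epsilon>") auto
  define p where "p = failure_sup x0 R L N qry out \<epsilon>"
  define r where "r s = s\<^sup>2 * (- ln (enn2real (p s)))" for s
  \<comment> \<open>\<open>C\<close> depends on \<open>\<delta>\<close>, so \<open>\<delta>\<close>
    has to be fixed before \<open>s\<close> tends to 0; the term \<open>s\<^sup>2 * ln C\<close>
    then vanishes in the limit.\<close>
  have bounds: "\<exists>C>0. \<forall>\<^sub>F s in at_right 0.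
      ereal (s\<^sup>2) * failure_exponent x0 R L N qry out \<epsilon> s = ereal (r s) \<and>
      r s \<le> (1 + \<delta>) * (T + \<delta>)\<^sup>2 / 2 \<and> (1 - \<delta>) * T\<^sup>2 / 2 - s\<^sup>2 * ln C \<le> r s"
    if \<delta>: "0 < \<delta>" "\<delta> \<le> 1" for \<delta>
  proof -
    obtain C where C: "C > 0"
      "\<And>s. s > 0 \<Longrightarrow> p s \<le> ennreal (C * exp (- (1 - \<delta>) * T\<^sup>2 / (2 * s\<^sup>2)))"
      unfolding p_def using failure_sup_upper[OF T(2,1) \<delta>] by metis
    from failure_sup_lower[OF assms(6) T(1) \<delta>(1)] eventually_at_right_less[of 0]
    have "\<forall>\<^sub>F s in at_right 0.
      ereal (s\<^sup>2) * failure_exponent x0 R L N qry out \<epsilon> s = ereal (r s) \<and>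
      r s \<le> (1 + \<delta>) * (T + \<delta>)\<^sup>2 / 2 \<and> (1 - \<delta>) * T\<^sup>2 / 2 - s\<^sup>2 * ln C \<le> r s"
    proof eventually_elim
      case (elim s)
      note b = neg_log_real_bounds[OF elim(1)[folded p_def] C(2)[OF elim(2)] exp_gt_zero]
      have "ereal (s\<^sup>2) * failure_exponent x0 R L N qry out \<epsilon> s = ereal (r s)"
        using b(1) by (simp add: failure_exponent_def p_def r_def)
      moreover have "r s \<le> s\<^sup>2 * ((1 + \<delta>) * (T + \<delta>)\<^sup>2 / (2 * s\<^sup>2))"
        unfolding r_def using b(3)
        by (intro mult_left_mono)
          (simp_all only: ln_exp mult_minus_left divide_minus_left minus_minus zero_le_power2)
      moreover have "s\<^sup>2 * ((1 - \<delta>) * T\<^sup>2 / (2 * s\<^sup>2) - ln C) \<le> r s"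
        unfolding r_def using b(2) C(1)
        by (intro mult_left_mono) (simp_all add: ln_mult minus_divide_left left_diff_distrib)
      ultimately show ?case using elim by (simp add: right_diff_distrib)
    qed
    with C(1) show ?thesis by blast
  qed
  have "(r \<longlongrightarrow> T\<^sup>2 / 2) (at_right 0)"
  \<comment> \<open>For each \<open>c\<close> strictly on one side of the limit,
    \<open>\<delta>\<close> is first chosen so small that the bound for this \<open>\<delta>\<close>
    still separates from \<open>c\<close>.\<close>
  proof (rule order_tendstoI)
    fix c assume c: "c < T\<^sup>2 / 2"
    have "((\<lambda>\<delta>. (1 - \<delta>) * T\<^sup>2 / 2) \<longlongrightarrow> T\<^sup>2 / 2) (at_right 0)" by (auto intro!: tendsto_eq_intros)
    then have "\<forall>\<^sub>F \<delta> in at_right 0. c < (1 - \<delta>) * T\<^sup>2 / 2 \<and> 0 < \<delta> \<and> \<delta> < 1"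
      using c by (intro eventually_conj order_tendstoD(1) eventually_at_right_less)
        (auto intro: eventually_at_right_real[of 0 1, THEN eventually_mono])
    then obtain \<delta> where \<delta>: "c < (1 - \<delta>) * T\<^sup>2 / 2" "0 < \<delta>" "\<delta> < 1"
      using eventually_happens trivial_limit_at_right_real by blast
    obtain C where "\<forall>\<^sub>F s in at_right 0.
      ereal (s\<^sup>2) * failure_exponent x0 R L N qry out \<epsilon> s = ereal (r s) \<and>
      r s \<le> (1 + \<delta>) * (T + \<delta>)\<^sup>2 / 2 \<and> (1 - \<delta>) * T\<^sup>2 / 2 - s\<^sup>2 * ln C \<le> r s"
      using bounds[of \<delta>] \<delta> by auto
    moreover have "((\<lambda>s. (1 - \<delta>) * T\<^sup>2 / 2 - s\<^sup>2 * ln C) \<longlongrightarrow> (1 - \<delta>) * T\<^sup>2 / 2) (at_right 0)"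
      by (auto intro!: tendsto_eq_intros)
    then have "\<forall>\<^sub>F s in at_right 0. c < (1 - \<delta>) * T\<^sup>2 / 2 - s\<^sup>2 * ln C"
      using \<delta> by (intro order_tendstoD(1))
    ultimately show "\<forall>\<^sub>F s in at_right 0. c < r s" by eventually_elim simp
  next
    fix c assume c: "T\<^sup>2 / 2 < c"
    have "((\<lambda>\<delta>. (1 + \<delta>) * (T + \<delta>)\<^sup>2 / 2) \<longlongrightarrow> T\<^sup>2 / 2) (at_right 0)"
      by (auto intro!: tendsto_eq_intros)
    then have "\<forall>\<^sub>F \<delta> in at_right 0. (1 + \<delta>) * (T + \<delta>)\<^sup>2 / 2 < c \<and> 0 < \<delta> \<and> \<delta> < 1"
      using c by (intro eventually_conj order_tendstoD(2) eventually_at_right_less)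
        (auto intro: eventually_at_right_real[of 0 1, THEN eventually_mono])
    then obtain \<delta> where \<delta>: "(1 + \<delta>) * (T + \<delta>)\<^sup>2 / 2 < c" "0 < \<delta>" "\<delta> < 1"
      using eventually_happens trivial_limit_at_right_real by blast
    have "\<forall>\<^sub>F s in at_right 0. r s \<le> (1 + \<delta>) * (T + \<delta>)\<^sup>2 / 2"
      using bounds[of \<delta>] \<delta> by (auto elim: eventually_mono)
    then show "\<forall>\<^sub>F s in at_right 0. r s < c" using \<delta> by (auto elim: eventually_mono)
  qed
  then have "((\<lambda>s. ereal (r s)) \<longlongrightarrow> ereal (T\<^sup>2 / 2)) (at_right 0)" by simp
  moreover have "\<forall>\<^sub>F s in at_right 0.
      ereal (r s) = ereal (s\<^sup>2) * failure_exponent x0 R L N qry out \<epsilon> s"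
    \<comment> \<open>Only the identity between \<open>r\<close> and the scaled exponent is
      extracted here, and any \<open>\<delta>\<close> in the allowed range provides it.\<close>
    using bounds[of 1] by (auto elim: eventually_mono)
  ultimately have "((\<lambda>s. ereal (s\<^sup>2) * failure_exponent x0 R L N qry out \<epsilon> s)
      \<longlongrightarrow> ereal (T\<^sup>2 / 2)) (at_right 0)"
    by (rule Lim_transform_eventually)
  then show ?thesis by (simp add: T)
qed

end
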